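(* For every integer $n\geq 1$, the polynomials $P_n(x)$, $Q_n(x)$, $T_n(x)$ and $S_n(x)$ have only real zeros. Moreover, $P_n(x)\prec_{int}Q_n(x)\prec_{int}P_{n+1}(x)$ and $S_n(x)\prec_{int}T_n(x)\prec_{int}S_{n+1}(x)$.
   Context: Strict interlacing: suppose $p,q\in\mathbb{R}[x]$ both have only real zeros, those of $p$ being $\xi_1<\cdots<\xi_n$ and those of $q$ being $\theta_1<\cdots<\theta_m$. We write $p\prec_{int}q$ ("$p$ strictly interlaces $q$") if $\deg q=1+\deg p$ and the zeros satisfy $\theta_1<\xi_1<\theta_2<\cdots<\xi_n<\theta_{n+1}$. (A nonzero constant polynomial has no zeros, so it strictly interlaces any polynomial of degree 1.) Let $\mathcal{C}_n$ be the set of permutations (rearrangements) of the multiset $\{1,1,2,2,\ldots,n,n\}$ and $\mathfrak{D}_n$ the set of permutations of the multiset $\{1,1,2,2,\ldots,n,n,n+1\}$. For a word $\sigma=\sigma_1\cdots\sigma_m$, $\mathrm{des}(\sigma)=\#\{i\in\{1,\ldots,m-1\}:\sigma_i>\sigma_{i+1}\}$. Define $P_n(x)=\sum_{\sigma\in\mathcal{C}_n}x^{\mathrm{des}(\sigma)}$ and $Q_n(x)=\sum_{\sigma\in\mathfrak{D}_n}x^{\mathrm{des}(\sigma)}$. Let $\mathcal{C}_n^{\pm}$ be the set of all distinct signed permutations of the multiset $\{1,1,2,2,\ldots,n,n\}$, i.e. all words $\pm\sigma_1\pm\sigma_2\cdots\pm\sigma_{2n}$ with $\sigma_1\cdots\sigma_{2n}\in\mathcal{C}_n$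 and each sign chosen arbitrarily. Let $\mathfrak{D}_n^{\pm}$ be the set of signed permutations of the multiset $\{1,1,2,2,\ldots,n,n,n+1\}$ in which the entry $n+1$ has a positive sign. For a signed word $\sigma=\sigma_1\cdots\sigma_m$ set $\sigma_0=0$ and $\mathrm{des}_B(\sigma)=\#\{i\in\{0,1,\ldots,m-1\}:\sigma_i>\sigma_{i+1}\}$. Define $S_n(x)=\sum_{\sigma\in\mathcal{C}_n^{\pm}}x^{\mathrm{des}_B(\sigma)}$ and $T_n(x)=\sum_{\sigma\in\mathfrak{D}_n^{\pm}}x^{\mathrm{des}_B(\sigma)}$. *)

theory Defs
  imports
    Complex_Main
    "HOL-Computational_Algebra.Computational_Algebra"
    "HOL-Combinatorics.Combinatorics"
begin

definition only_real_zeros :: "real poly \<Rightarrow> bool" where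
  "only_real_zeros p \<longleftrightarrow>
     p \<noteq> 0 \<and> (\<forall>z::complex. poly (map_poly complex_of_real p) z = 0 \<longrightarrow> z \<in> \<real>)"

text \<open>
  The zeros are listed with multiplicity, so the strict ordering of the lists says that they are
  simple. Together with \<^const>\<open>only_real_zeros\<close> this makes the length of each list the degree of its
  polynomial.
\<close>
definition strictly_interlaces :: "real poly \<Rightarrow> real poly \<Rightarrow> bool"
    (infix "\<prec>\<^sub>i\<^sub>n\<^sub>t" 50) where
  "p \<prec>\<^sub>i\<^sub>n\<^sub>t q \<longleftrightarrow>
     only_real_zeros p \<and> only_real_zeros q \<and> degree q = 1 + degree p \<and>
     (\<exists>\<xi> \<theta>. mset \<xi> = proots p \<and> sorted_wrt (<) \<xi> \<and>
            mset \<theta> = proots q \<and> sorted_wrt (<) \<theta> \<and>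
            (\<forall>i < length \<xi>. \<theta> ! i < \<xi> ! i \<and> \<xi> ! i < \<theta> ! (i + 1)))"

definition C_mset :: "nat \<Rightarrow> nat multiset" where
  "C_mset n = (\<Sum>i\<in>{1..n}. {#i, i#})"

definition D_mset :: "nat \<Rightarrow> nat multiset" where
  "D_mset n = C_mset n + {#n + 1#}"

definition C_perms :: "nat \<Rightarrow> nat list set" where
  "C_perms n = permutations_of_multiset (C_mset n)"

definition D_perms :: "nat \<Rightarrow> nat list set" where
  "D_perms n = permutations_of_multiset (D_mset n)"

definition des :: "'a::linorder list \<Rightarrow> nat" where
  "des w = card {i. i + 1 < length w \<and> w ! i > w ! (i + 1)}"

definition P_poly :: "nat \<Rightarrow> real poly" where
  "P_poly n = (\<Sum>\<sigma>\<in>C_perms n. monom 1 (des \<sigma>))"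

definition Q_poly :: "nat \<Rightarrow> real poly" where
  "Q_poly n = (\<Sum>\<sigma>\<in>D_perms n. monom 1 (des \<sigma>))"

text \<open>Signed words are integer lists; forgetting the signs gives the underlying word.\<close>

definition unsigned_word :: "int list \<Rightarrow> nat list" where
  "unsigned_word w = map (\<lambda>a. nat \<bar>a\<bar>) w"

definition C_signed :: "nat \<Rightarrow> int list set" where
  "C_signed n = {w. unsigned_word w \<in> C_perms n}"

definition D_signed :: "nat \<Rightarrow> int list set" where
  "D_signed n = {w. unsigned_word w \<in> D_perms n \<and> int (n + 1) \<in> set w}"

definition des_B :: "int list \<Rightarrow> nat" where
  "des_B w = des (0 # w)"

definition S_poly :: "nat \<Rightarrow> real poly" where
  "S_poly n = (\<Sum>\<sigma>\<in>C_signed n. monom 1 (des_B \<sigma>))"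

definition T_poly :: "nat \<Rightarrow> real poly" where
  "T_poly n = (\<Sum>\<sigma>\<in>D_signed n. monom 1 (des_B \<sigma>))"

text \<open>All four sums range over finite sets.\<close>

lemma finite_C_perms: "finite (C_perms n)"
  by (simp add: C_perms_def)

lemma finite_D_perms: "finite (D_perms n)"
  by (simp add: D_perms_def)

lemma finite_unsigned_word_vimage:
  assumes "finite A"
  shows "finite {w. unsigned_word w \<in> A}"
proof -
  have "finite {w. unsigned_word w = v}" for v
  proof (rule finite_subset)
    let ?E = "(int ` set v) \<union> ((\<lambda>a. - int a) ` set v)"
    show "{w. unsigned_word w = v} \<subseteq> {w. set w \<subseteq> ?E \<and> length w = length v}"
    proof (intro subsetI CollectI conjI)
      fix w and a :: int
      assume "w \<in> {w. unsigned_word w = v}"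
      then have v: "v = map (\<lambda>a. nat \<bar>a\<bar>) w"
        by (simp add: unsigned_word_def)
      show "length w = length v"
        using v by simp
      assume "a \<in> set w"
      then have "nat \<bar>a\<bar> \<in> set v"
        using v by simp
      moreover have "a = int (nat \<bar>a\<bar>) \<or> a = - int (nat \<bar>a\<bar>)"
        by linarith
      ultimately show "a \<in> ?E"
        by blast
    qed
    show "finite {w. set w \<subseteq> ?E \<and> length w = length v}"
      by (rule finite_lists_length_eq) auto
  qed
  moreover have "{w. unsigned_word w \<in> A} = (\<Union>v\<in>A. {w. unsigned_word w = v})"
    by auto
  ultimately show ?thesis using assms by auto
qed

lemma finite_C_signed: "finite (C_signed n)"
  unfolding C_signed_def by (rule finite_unsigned_word_vimage[OF finite_C_perms])

lemma finite_D_signed: "finite (D_signed n)"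
  by (rule finite_subset[OF _ finite_unsigned_word_vimage[OF finite_D_perms[of n]]])
     (auto simp: D_signed_def)

end

theory Submission
  imports Defs
begin

text \<open>
  Counting the ways to insert a largest (or smallest) letter into a word according to its descents
  shows that each polynomial arises from its predecessor \<open>p\<close> as
  \<open>(a + b x) p(x) + c x (1 - x) p'(x)\<close> with \<open>a, c > 0\<close> and \<open>b > c deg p\<close>. If \<open>p\<close> has simple negative
  zeros, this expression changes sign between consecutive points of the list minus infinity, zeros
  of \<open>p\<close>, \<open>0\<close>, and so has exactly one zero in each of these gaps.
\<close>

section \<open>Polynomials with simple negative zeros\<close>

text \<open>The zeros are carried as an explicit increasing list because interlacing compares them
  by index. The positive factor \<open>c\<close> fixes the sign of \<open>p\<close> between any two
  consecutive zeros.\<close>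

definition neg_rooted :: "real poly \<Rightarrow> real list \<Rightarrow> bool" where
  "neg_rooted p \<xi> \<longleftrightarrow> sorted_wrt (<) \<xi> \<and> (\<forall>x\<in>set \<xi>. x < 0) \<and>
     (\<exists>c>0. p = smult c (\<Prod>x\<leftarrow>\<xi>. [:-x, 1:]))"

lemma prod_list_linear_neq_0: "(\<Prod>x\<leftarrow>\<xi>. [:-x, 1:]) \<noteq> (0 :: 'a::idom poly)"
  by (auto simp: prod_list_zero_iff)

lemma degree_prod_list_linear: "degree (\<Prod>x\<leftarrow>\<xi>. [:-x, 1:] :: 'a::idom poly) = length \<xi>"
  by (induction \<xi>) (auto simp: degree_mult_eq prod_list_linear_neq_0 simp del: mult_pCons_left)

lemma lead_coeff_prod_list_linear: "lead_coeff (\<Prod>x\<leftarrow>\<xi>. [:-x, 1:] :: 'a::idom poly) = 1"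
  by (induction \<xi>) (auto simp: lead_coeff_mult simp del: mult_pCons_left)

lemma proots_prod_list_linear: "proots (\<Prod>x\<leftarrow>\<xi>. [:-x, 1:] :: 'a::idom poly) = mset \<xi>"
  by (induction \<xi>) (auto simp: proots_mult prod_list_linear_neq_0 simp del: mult_pCons_left)

lemma poly_prod_list_linear: "poly (\<Prod>x\<leftarrow>\<xi>. [:-x, 1:]) y = (\<Prod>x\<leftarrow>\<xi>. y - x :: 'a::comm_ring_1)"
  by (induction \<xi>) (auto simp: algebra_simps)

lemma neg_rooted_degree: "neg_rooted p \<xi> \<Longrightarrow> degree p = length \<xi>"
  by (auto simp: neg_rooted_def degree_prod_list_linear)

lemma neg_rooted_lead_coeff: "neg_rooted p \<xi> \<Longrightarrow> lead_coeff p > 0"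
  by (auto simp: neg_rooted_def lead_coeff_prod_list_linear[simplified])

lemma neg_rooted_proots: "neg_rooted p \<xi> \<Longrightarrow> proots p = mset \<xi>"
  by (auto simp: neg_rooted_def proots_prod_list_linear)

lemma neg_rooted_const: "c > 0 \<Longrightarrow> neg_rooted [:c:] []"
  by (auto simp: neg_rooted_def intro!: exI[of _ c])

text \<open>Extending the coefficients to the complex numbers preserves the factorisation into
  linear factors, so every complex zero is one of the listed reals.\<close>

lemma neg_rooted_only_real_zeros:
  assumes "neg_rooted p \<xi>"
  shows "only_real_zeros p"
proof -
  obtain c where c: "c > 0" "p = smult c (\<Prod>x\<leftarrow>\<xi>. [:-x, 1:])"
    using assms by (auto simp: neg_rooted_def)
  have "poly (map_poly complex_of_real (\<Prod>x\<leftarrow>\<xi>. [:-x, 1:])) z = (\<Prod>x\<leftarrow>\<xi>. z - of_real x)" for z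
  proof (induction \<xi>)
    case (Cons a \<xi>)
    have "map_poly complex_of_real ([:-a, 1:] * q) = [:- of_real a, 1:] * map_poly of_real q" for q
      by (intro poly_eqI) (auto simp: coeff_map_poly coeff_pCons split: nat.splits)
    then have "poly (map_poly complex_of_real ([:-a, 1:] * q)) z = (z - of_real a) * poly (map_poly of_real q) z" for q
      by (simp only: poly_mult) simp
    then show ?case using Cons by (simp del: mult_pCons_left)
  qed simp
  moreover have "map_poly complex_of_real p = smult (of_real c) (map_poly of_real (\<Prod>x\<leftarrow>\<xi>. [:-x, 1:]))"
    unfolding c by (intro poly_eqI) (auto simp: coeff_map_poly)
  ultimately have "poly (map_poly complex_of_real p) z = of_real c * (\<Prod>x\<leftarrow>\<xi>. z - of_real x)" for z
    by simp
  then show ?thesis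
    using c prod_list_linear_neq_0[of \<xi>] by (auto simp: only_real_zeros_def prod_list_zero_iff)
qed

lemma strictly_interlacesI:
  assumes "neg_rooted p \<xi>" "neg_rooted q \<theta>" "length \<theta> = Suc (length \<xi>)"
    and "\<And>i. i < length \<xi> \<Longrightarrow> \<theta> ! i < \<xi> ! i \<and> \<xi> ! i < \<theta> ! Suc i"
  shows "p \<prec>\<^sub>i\<^sub>n\<^sub>t q"
proof -
  have "sorted_wrt (<) \<xi>" "sorted_wrt (<) \<theta>" using assms by (auto simp: neg_rooted_def)
  moreover have "degree q = 1 + degree p" using assms by (simp add: neg_rooted_degree)
  ultimately show ?thesis
    unfolding strictly_interlaces_def
    using assms(4) neg_rooted_only_real_zeros[OF assms(1)] neg_rooted_only_real_zeros[OF assms(2)]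
      neg_rooted_proots[OF assms(1)] neg_rooted_proots[OF assms(2)]
    by (metis Suc_eq_plus1)
qed

section \<open>Locating all zeros through sign changes\<close>

lemma poly_eq_prod_list_linear:
  fixes p :: "'a::idom poly"
  assumes "distinct \<theta>" "degree p = length \<theta>" "\<forall>x\<in>set \<theta>. poly p x = 0" "p \<noteq> 0"
  shows "p = smult (lead_coeff p) (\<Prod>x\<leftarrow>\<theta>. [:-x, 1:])"
  using assms
proof (induction \<theta> arbitrary: p)
  case Nil
  then show ?case by (auto elim!: degree_eq_zeroE)
next
  case (Cons a \<theta>)
  obtain q where q: "p = [:-a, 1:] * q"
    using Cons.prems by (auto simp: poly_eq_0_iff_dvd elim!: dvdE)
  have q0: "q \<noteq> 0" using Cons.prems q by auto
  have deg: "degree q = length \<theta>"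
    using Cons.prems(2) q0 unfolding q by (subst (asm) degree_mult_eq) auto
  \<comment> \<open>The factor x - a is nonzero at the remaining points, which differ from
    \<open>a\<close> by distinctness, so they are zeros of the cofactor.\<close>
  have "poly p x = (x - a) * poly q x" for x
    unfolding q by (simp add: algebra_simps)
  then have "\<forall>x\<in>set \<theta>. poly q x = 0"
    using Cons.prems by auto
  then have IH: "q = smult (lead_coeff q) (\<Prod>x\<leftarrow>\<theta>. [:-x, 1:])"
    using Cons.IH[of q] Cons.prems q0 deg by simp
  have lc: "lead_coeff p = lead_coeff q"
    unfolding q by (simp only: lead_coeff_mult) simp
  show ?case
    unfolding lc by (subst q, subst IH) (simp del: mult_pCons_left)
qed

text \<open>The points of \<open>ys\<close> bound as many gaps as the degree, and the intermediate
  value theorem puts a zero in each. These zeros already exhaust the degree, so there are no others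
  and all are simple. They are negative because \<open>ys\<close> ends at or below 0.\<close>

lemma sign_changes_roots:
  fixes p :: "real poly"
  assumes deg: "length ys = Suc (degree p)" and sorted: "sorted_wrt (<) ys"
    and last: "last ys \<le> 0" and lc: "lead_coeff p > 0"
    and sign: "\<And>i. i < degree p \<Longrightarrow> poly p (ys ! i) * poly p (ys ! Suc i) < 0"
  obtains \<theta> where "neg_rooted p \<theta>" "\<And>i. i < degree p \<Longrightarrow> ys ! i < \<theta> ! i \<and> \<theta> ! i < ys ! Suc i"
proof -
  have "\<forall>i. \<exists>t. i < degree p \<longrightarrow> ys ! i < t \<and> t < ys ! Suc i \<and> poly p t = 0"
  proof (intro allI)
    fix i
    show "\<exists>t. i < degree p \<longrightarrow> ys ! i < t \<and> t < ys ! Suc i \<and> poly p t = 0"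
    proof (cases "i < degree p")
      case True
      then have "ys ! i < ys ! Suc i"
        using sorted deg by (auto simp: sorted_wrt_iff_nth_less)
      then show ?thesis using poly_IVT[OF _ sign[OF True]] by auto
    qed auto
  qed
  then obtain t where t: "\<And>i. i < degree p \<Longrightarrow> ys ! i < t i \<and> t i < ys ! Suc i \<and> poly p (t i) = 0"
    by metis
  define \<theta> where "\<theta> = map t [0..<degree p]"
  have le: "ys ! i \<le> ys ! j" if "i \<le> j" "j < length ys" for i j
    using sorted that by (cases "i = j") (auto simp: sorted_wrt_iff_nth_less intro: less_imp_le)
  have s: "sorted_wrt (<) \<theta>"
    unfolding sorted_wrt_iff_nth_less
  proof (intro allI impI)
    fix i j assume ij: "i < j" "j < length \<theta>"
    then have "t i < ys ! Suc i" "ys ! Suc i \<le> ys ! j" "ys ! j < t j"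
      using t[of i] t[of j] le[of "Suc i" j] deg by (auto simp: \<theta>_def)
    then show "\<theta> ! i < \<theta> ! j" using ij by (simp add: \<theta>_def)
  qed
  have "t i < 0" if "i < degree p" for i
  proof -
    have "ys ! Suc i \<le> last ys"
      using that deg le[of "Suc i" "degree p"] by (subst last_conv_nth) auto
    then show ?thesis using t[OF that] last by linarith
  qed
  then have neg: "\<forall>x\<in>set \<theta>. x < 0" by (auto simp: \<theta>_def)
  have "distinct \<theta>" using s by (auto simp: strict_sorted_iff)
  then have "p = smult (lead_coeff p) (\<Prod>x\<leftarrow>\<theta>. [:-x, 1:])"
    using lc t by (intro poly_eq_prod_list_linear) (auto simp: \<theta>_def)
  then have "neg_rooted p \<theta>"
    unfolding neg_rooted_def using s neg lc by blast
  then show ?thesis using that[of \<theta>] t by (auto simp: \<theta>_def)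
qed

text \<open>Reflecting x to -x turns the behaviour at minus infinity into that at plus infinity; the
  factor (-1)^degree restores the sign of the leading coefficient.\<close>

lemma poly_sign_at_bot:
  fixes p :: "real poly"
  assumes "lead_coeff p > 0"
  obtains y where "y < b" "(-1) ^ degree p * poly p y > 0"
proof -
  define q where "q = smult ((-1) ^ degree p) (pcompose p [:0, -1:])"
  have "lead_coeff q = lead_coeff p"
    unfolding q_def by (simp add: lead_coeff_comp lead_coeff_smult flip: power_mult_distrib)
  then have "lead_coeff q > 0" using assms by simp
  then obtain N where N: "\<And>x. x \<ge> N \<Longrightarrow> poly q x \<ge> lead_coeff q"
    using poly_pinfty_gt_lc by blast
  \<comment> \<open>This choice gives both -y >= N and y <= b - 1.\<close>
  define y where "y = - max N (1 - b)"
  have "poly q (- y) > 0" using N[of "-y"] \<open>lead_coeff q > 0\<close> by (simp add: y_def)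
  then have "(-1) ^ degree p * poly p y > 0" by (simp add: q_def poly_pcompose)
  moreover have "y < b" by (simp add: y_def)
  ultimately show ?thesis using that by blast
qed

lemma sgn_prod_list_diff:
  fixes x :: real
  assumes "\<forall>y\<in>set us. y < x" "\<forall>y\<in>set vs. x < y"
  shows "(-1) ^ length vs * ((\<Prod>y\<leftarrow>us. x - y) * (\<Prod>y\<leftarrow>vs. x - y)) > 0"
proof -
  have "(\<Prod>y\<leftarrow>us. x - y) > 0" using assms(1) by (induction us) auto
  moreover have "(-1) ^ length vs * (\<Prod>y\<leftarrow>vs. x - y) > 0" using assms(2)
  proof (induction vs)
    case (Cons a vs)
    have "(-1) ^ length (a # vs) * (\<Prod>y\<leftarrow>a # vs. x - y) = (a - x) * ((-1) ^ length vs * (\<Prod>y\<leftarrow>vs. x - y))"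
      by (simp add: algebra_simps)
    then show ?case using Cons by (auto intro!: mult_pos_pos)
  qed simp
  ultimately show ?thesis using mult_pos_pos by (fastforce simp: algebra_simps)
qed

text \<open>Writing p = (x - r) h with r the chosen zero gives p'(r) = h(r). Its negative factors
  come exactly from the zeros to the right of r, which the exponent counts.\<close>

lemma pderiv_sign_at_root:
  assumes "neg_rooted p \<xi>" "i < length \<xi>"
  shows "(-1) ^ (length \<xi> - Suc i) * poly (pderiv p) (\<xi> ! i) > 0"
proof -
  obtain c where c: "c > 0" "p = smult c (\<Prod>x\<leftarrow>\<xi>. [:-x, 1:])"
    using assms by (auto simp: neg_rooted_def)
  define us vs x where "us = take i \<xi>" and "vs = drop (Suc i) \<xi>" and "x = \<xi> ! i"
  have split: "\<xi> = us @ x # vs" using assms by (simp add: us_def vs_def x_def id_take_nth_drop)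
  have "sorted_wrt (<) \<xi>" using assms by (simp add: neg_rooted_def)
  then have ord: "\<forall>y\<in>set us. y < x" "\<forall>y\<in>set vs. x < y"
    unfolding split by (auto simp: sorted_wrt_append)
  have "p = [:-x, 1:] * smult c ((\<Prod>x\<leftarrow>us. [:-x, 1:]) * (\<Prod>x\<leftarrow>vs. [:-x, 1:]))"
    unfolding c split by (simp del: mult_pCons_left add: mult.left_commute)
  then have "poly (pderiv p) x = c * ((\<Prod>y\<leftarrow>us. x - y) * (\<Prod>y\<leftarrow>vs. x - y))"
    by (simp only: pderiv_mult) (simp add: pderiv_pCons poly_prod_list_linear)
  moreover have "length vs = length \<xi> - Suc i" by (simp add: vs_def)
  ultimately show ?thesis
    using sgn_prod_list_diff[OF ord] c(1) unfolding x_def[symmetric]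
    by (metis mult.left_commute mult_pos_pos)
qed

section \<open>The Eulerian operator\<close>

text \<open>The factor \<open>[:0, 1, -1:]\<close> is x (1 - x). With a = 1, b = n, c = 1 this is
  the classical recurrence of the Eulerian polynomials.\<close>

definition eulerian_op :: "real \<Rightarrow> real \<Rightarrow> real \<Rightarrow> real poly \<Rightarrow> real poly" where
  "eulerian_op a b c p = [:a, b:] * p + smult c ([:0, 1, -1:] * pderiv p)"

lemma degree_eulerian_op_le: "degree (eulerian_op a b c p) \<le> Suc (degree p)"
  by (rule degree_le) (auto simp: eulerian_op_def coeff_pderiv coeff_eq_0 coeff_pCons split: nat.splits)

text \<open>This is the source of the condition b > c deg p: it makes the degree grow by exactly one
  and keeps the leading coefficient positive.\<close>

lemma coeff_eulerian_op_Suc_degree: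
  "coeff (eulerian_op a b c p) (Suc (degree p)) = (b - c * real (degree p)) * lead_coeff p"
  by (auto simp: eulerian_op_def coeff_pderiv coeff_eq_0 coeff_pCons algebra_simps split: nat.splits)

text \<open>
  At a zero of \<open>p\<close> the operator returns \<open>c x (1 - x) p'(x)\<close>, whose sign alternates along the
  zeros; the values at \<open>0\<close> and towards minus infinity supply the two outer sign changes.
\<close>

lemma eulerian_op_neg_rooted:
  assumes p: "neg_rooted p \<xi>" and a: "a > 0" and c: "c > 0" and b: "b > c * real (degree p)"
  obtains \<theta> where "neg_rooted (eulerian_op a b c p) \<theta>" "length \<theta> = Suc (length \<xi>)"
    "\<And>i. i < length \<xi> \<Longrightarrow> \<theta> ! i < \<xi> ! i \<and> \<xi> ! i < \<theta> ! Suc i"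
proof -
  define g where "g = eulerian_op a b c p"
  define d where "d = length \<xi>"
  have dp: "degree p = d" using neg_rooted_degree[OF p] by (simp add: d_def)
  have "coeff g (Suc d) > 0"
    using coeff_eulerian_op_Suc_degree[of a b c p] neg_rooted_lead_coeff[OF p] b
    by (simp add: g_def dp)
  then have dg: "degree g = Suc d" and lc: "lead_coeff g > 0"
    using degree_eulerian_op_le[of a b c p] le_degree[of g "Suc d"] by (auto simp: g_def dp)
  obtain y where y: "y < Min (insert 0 (set \<xi>))" "(-1) ^ degree g * poly g y > 0"
    using poly_sign_at_bot[OF lc] by blast
  define ys where "ys = y # \<xi> @ [0]"
  have \<xi>: "sorted_wrt (<) \<xi>" "\<forall>x\<in>set \<xi>. x < 0" using p by (auto simp: neg_rooted_def)
  have sorted: "sorted_wrt (<) ys"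
    using \<xi> y(1) by (auto simp: ys_def sorted_wrt_append)
  have root: "poly p x = 0" if "x \<in> set \<xi>" for x
    using p that by (auto simp: neg_rooted_def poly_prod_list_linear prod_list_zero_iff)
  \<comment> \<open>The exponent counts the points of \<open>ys\<close> to the right of index
    \<open>i\<close>, so the signs alternate and end with a positive value at 0.\<close>
  have sgn: "(-1) ^ (Suc d - i) * poly g (ys ! i) > 0" if i: "i \<le> Suc d" for i
  proof -
    consider "i = 0" | j where "i = Suc j" "j < d" | "i = Suc d"
      using i by (cases i) (auto simp: le_less)
    then show ?thesis
    proof cases
      case 1
      then show ?thesis using y(2) by (simp add: ys_def dg)
    next
      case 2
      define x where "x = \<xi> ! j"
      have xs: "x \<in> set \<xi>" "x < 0" using 2 \<xi> by (auto simp: x_def d_def)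
      have gx: "poly g x = c * (x * (1 - x)) * poly (pderiv p) x"
        by (simp add: g_def eulerian_op_def root[OF xs(1)] algebra_simps)
      have e: "Suc d - i = Suc (d - Suc j)" using 2 by simp
      have yi: "ys ! i = x" using 2 by (simp add: ys_def x_def nth_append d_def)
      \<comment> \<open>Since x < 0, the factor c x (1 - x) is negative; this supplies the one sign
        by which the exponent exceeds that of the derivative of \<open>p\<close>.\<close>
      have "- c * (x * (1 - x)) > 0"
        using xs(2) c by (intro mult_neg_neg mult_neg_pos) auto
      moreover have "(-1) ^ (d - Suc j) * poly (pderiv p) x > 0"
        using pderiv_sign_at_root[OF p, of j] 2 by (simp add: d_def x_def)
      ultimately have "(- c * (x * (1 - x))) * ((-1) ^ (d - Suc j) * poly (pderiv p) x) > 0"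
        by (rule mult_pos_pos)
      then show ?thesis unfolding e yi gx by (simp add: mult.left_commute)
    next
      case 3
      obtain k where "k > 0" "p = smult k (\<Prod>x\<leftarrow>\<xi>. [:-x, 1:])"
        using p by (auto simp: neg_rooted_def)
      \<comment> \<open>All zeros are negative, so p(0) > 0, and the operator multiplies the value
        at 0 by \<open>a\<close>.\<close>
      moreover have "(\<Prod>x\<leftarrow>\<xi>. 0 - x) > 0"
        using \<xi>(2) by (induction \<xi>) (auto simp: mult_neg_pos)
      ultimately have "poly p 0 > 0"
        by (simp add: poly_prod_list_linear del: diff_0)
      then show ?thesis
        using a 3 by (simp add: ys_def nth_append d_def g_def eulerian_op_def)
    qed
  qed
  have "poly g (ys ! i) * poly g (ys ! Suc i) < 0" if "i < degree g" for i
  proof -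
    have e: "Suc d - i = Suc (d - i)" and le: "i \<le> Suc d" "Suc i \<le> Suc d" using that dg by auto
    have "((-1) ^ Suc (d - i) * poly g (ys ! i)) * ((-1) ^ (d - i) * poly g (ys ! Suc i)) > 0"
      using mult_pos_pos[OF sgn[OF le(1)] sgn[OF le(2)]] unfolding e diff_Suc_Suc .
    also have "\<dots> = - (((-1) ^ (d - i) * (-1) ^ (d - i)) * (poly g (ys ! i) * poly g (ys ! Suc i)))"
      by (simp add: algebra_simps)
    also have "(-1) ^ (d - i) * (-1) ^ (d - i) = (1 :: real)"
      by (simp flip: power_mult_distrib)
    finally show ?thesis by simp
  qed
  moreover have "length ys = Suc (degree g)" "last ys \<le> 0" by (simp_all add: ys_def dg d_def)
  ultimately obtain \<theta> where \<theta>: "neg_rooted g \<theta>"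
    "\<And>i. i < degree g \<Longrightarrow> ys ! i < \<theta> ! i \<and> \<theta> ! i < ys ! Suc i"
    using sign_changes_roots[OF _ sorted _ lc] by metis
  \<comment> \<open>Prepending \<open>y\<close> shifts indices: \<open>\<xi> ! i\<close> is
    \<open>ys ! Suc i\<close>, the common endpoint of the gaps containing
    \<open>\<theta> ! i\<close> and \<open>\<theta> ! Suc i\<close>.\<close>
  have "\<theta> ! i < \<xi> ! i \<and> \<xi> ! i < \<theta> ! Suc i" if "i < length \<xi>" for i
    using \<theta>(2)[of i] \<theta>(2)[of "Suc i"] that by (simp add: ys_def nth_append dg d_def)
  moreover have "length \<theta> = Suc (length \<xi>)"
    using neg_rooted_degree[OF \<theta>(1)] dg d_def by simp
  ultimately show ?thesis using that \<theta>(1) g_def by blast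
qed

section \<open>Commutation of the operators and their action on monomials\<close>

lemma poly_eulerian_op:
  "poly (eulerian_op a b c p) x = (a + b * x) * poly p x + c * (x * (1 - x)) * poly (pderiv p) x"
  by (simp add: eulerian_op_def algebra_simps)

lemma poly_pderiv_eulerian_op:
  "poly (pderiv (eulerian_op a b c p)) x = b * poly p x + (a + b * x + c * (1 - 2 * x)) * poly (pderiv p) x +
     c * (x * (1 - x)) * poly (pderiv (pderiv p)) x"
  by (simp add: eulerian_op_def pderiv_mult pderiv_add pderiv_smult pderiv_minus pderiv_pCons algebra_simps)

lemma eulerian_op_commute:
  assumes "c' * (a + b) = c * (a' + b')"
  shows "eulerian_op a (b + c) c (eulerian_op a' b' c' p) =
         eulerian_op a' (b' + c') c' (eulerian_op a b c p)"
proof (rule poly_ext)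
  fix x
  define u v w where "u = poly p x" and "v = poly (pderiv p) x" and "w = poly (pderiv (pderiv p)) x"
  \<comment> \<open>The values of p, p' and p'' are treated as independent unknowns. The two
    composites then differ only by a multiple of x p(x), whose coefficient vanishes by the
    hypothesis.\<close>
  have "(a + (b + c) * x) * ((a' + b' * x) * u + c' * (x * (1 - x)) * v) +
      c * (x * (1 - x)) * (b' * u + (a' + b' * x + c' * (1 - 2 * x)) * v + c' * (x * (1 - x)) * w) =
    (a' + (b' + c') * x) * ((a + b * x) * u + c * (x * (1 - x)) * v) +
      c' * (x * (1 - x)) * (b * u + (a + b * x + c * (1 - 2 * x)) * v + c * (x * (1 - x)) * w) +
    (c * (a' + b') - c' * (a + b)) * x * u"
    by (simp add: algebra_simps)
  then show "poly (eulerian_op a (b + c) c (eulerian_op a' b' c' p)) x =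
      poly (eulerian_op a' (b' + c') c' (eulerian_op a b c p)) x"
    unfolding poly_eulerian_op poly_pderiv_eulerian_op u_def[symmetric] v_def[symmetric] w_def[symmetric]
    using assms by simp
qed

text \<open>This is the combinatorial reading of the operator: a word with \<open>k\<close> descents
  produces c k + a words with \<open>k\<close> descents and b - c k words with one more.\<close>

lemma eulerian_op_monom:
  "eulerian_op a b c (monom 1 k) = monom (c * real k + a) k + monom (b - c * real k) (Suc k)"
  by (rule poly_ext, cases k)
    (simp_all add: poly_eulerian_op pderiv_monom poly_monom algebra_simps)

lemma eulerian_op_sum: "eulerian_op a b c (sum f W) = (\<Sum>w\<in>W. eulerian_op a b c (f w))"
proof -
  have "eulerian_op a b c (p + q) = eulerian_op a b c p + eulerian_op a b c q" for p q
    by (rule poly_ext) (simp add: poly_eulerian_op pderiv_add algebra_simps)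
  then show ?thesis
    by (induction W rule: infinite_finite_induct) (auto simp: eulerian_op_def)
qed

lemma eulerian_op_sum_monom:
  "(\<Sum>w\<in>W. monom (c * real (j w) + a) (j w) + monom (b - c * real (j w)) (Suc (j w))) =
     eulerian_op a b c (\<Sum>w\<in>W. monom 1 (j w))"
  by (simp add: eulerian_op_sum eulerian_op_monom)

section \<open>Inserting an extreme letter\<close>

lemma smult_sum_right: "smult c (sum f A) = (\<Sum>x\<in>A. smult c (f x))"
  by (induction A rule: infinite_finite_induct) (auto simp: smult_add_right)

lemma des_Nil [simp]: "des [] = 0"
  and des_singleton [simp]: "des [x] = 0"
  by (simp_all add: des_def)

lemma des_Cons_Cons [simp]: "des (x # y # w) = (if y < x then 1 else 0) + des (y # w)"
proof -
  let ?A = "{i. i + 1 < length (y # w) \<and> (y # w) ! i > (y # w) ! (i + 1)}"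
  have "{i. i + 1 < length (x # y # w) \<and> (x # y # w) ! i > (x # y # w) ! (i + 1)} =
        (if y < x then {0} else {}) \<union> Suc ` ?A"
  proof (intro set_eqI)
    fix i
    show "i \<in> {i. i + 1 < length (x # y # w) \<and> (x # y # w) ! i > (x # y # w) ! (i + 1)} \<longleftrightarrow>
      i \<in> (if y < x then {0} else {}) \<union> Suc ` ?A"
      by (cases i) (auto simp: image_iff)
  qed
  moreover have "card ((if y < x then {0} else {}) \<union> Suc ` ?A) = card (if y < x then {0::nat} else {}) + card (Suc ` ?A)"
    by (intro card_Un_disjoint) auto
  ultimately show ?thesis by (simp add: des_def card_image)
qed

text \<open>The letter \<open>a\<close> stands fixed in front, and \<open>m\<close> is inserted only
  behind it. The recurrences use a = 0, which is harmless for words of naturals and is the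
  convention of \<open>des_B\<close> for signed words; an arbitrary \<open>a\<close> is what
  induction on the word requires.\<close>

definition insertion_sum :: "'a::linorder \<Rightarrow> 'a \<Rightarrow> 'a list \<Rightarrow> real poly" where
  "insertion_sum m a w = (\<Sum>i\<le>length w. monom 1 (des (a # take i w @ m # drop i w)))"

lemma insertion_sum_Nil [simp]: "insertion_sum m a [] = monom 1 (if m < a then 1 else 0)"
  by (simp add: insertion_sum_def)

lemma insertion_sum_Cons:
  "insertion_sum m a (b # w) = monom 1 (des (a # m # b # w)) +
     monom 1 (if b < a then 1 else 0) * insertion_sum m b w"
proof -
  have "insertion_sum m a (b # w) = monom 1 (des (a # m # b # w)) +
     (\<Sum>i\<le>length w. monom 1 (des (a # b # take i w @ m # drop i w)))"
    unfolding insertion_sum_def by (simp add: sum.atMost_Suc_shift del: sum.atMost_Suc des_Cons_Cons)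
  then show ?thesis
    by (simp add: insertion_sum_def sum_distrib_left mult_monom)
qed

text \<open>A largest letter leaves the number of descents unchanged exactly in a descent, at the
  end, or just before another copy of \<open>m\<close>; in any other gap it adds one. No gap before
  a copy of \<open>m\<close> is a descent, so the cases do not overlap.\<close>

lemma insertion_sum_max:
  assumes "a \<le> m" "\<forall>x\<in>set w. x \<le> m"
  shows "insertion_sum m a w =
    monom (real (des (a # w)) + 1 + real (count_list w m)) (des (a # w)) +
    monom (real (length w) - real (des (a # w)) - real (count_list w m)) (Suc (des (a # w)))"
  using assms
proof (induction w arbitrary: a)
  case (Cons b w)
  have IH: "insertion_sum m b w =
    monom (real (des (b # w)) + 1 + real (count_list w m)) (des (b # w)) +
    monom (real (length w) - real (des (b # w)) - real (count_list w m)) (Suc (des (b # w)))"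
    using Cons by simp
  consider "b < a" "b < m" "b \<noteq> m" | "\<not> b < a" "b = m" | "\<not> b < a" "b < m" "b \<noteq> m"
    using Cons.prems by force
  then show ?case
    using Cons.prems unfolding insertion_sum_Cons IH
    by cases (rule poly_ext; simp add: poly_monom algebra_simps)+
qed auto

text \<open>A smallest letter leaves the number of descents unchanged exactly in a descent or just
  after another copy of \<open>m\<close>; elsewhere, the end included, it adds one. Here a copy in
  front counts too, hence \<open>a # w\<close>.\<close>

lemma insertion_sum_min:
  assumes "m \<le> a" "\<forall>x\<in>set w. m \<le> x"
  shows "insertion_sum m a w =
    monom (real (des (a # w)) + real (count_list (a # w) m)) (des (a # w)) +
    monom (real (length w) + 1 - real (des (a # w)) - real (count_list (a # w) m)) (Suc (des (a # w)))"
  using assms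
proof (induction w arbitrary: a)
  case (Cons b w)
  have IH: "insertion_sum m b w =
    monom (real (des (b # w)) + real (count_list (b # w) m)) (des (b # w)) +
    monom (real (length w) + 1 - real (des (b # w)) - real (count_list (b # w) m)) (Suc (des (b # w)))"
    using Cons by simp
  consider "b < a" "m < a" "a \<noteq> m" | "\<not> b < a" "a = m" | "\<not> b < a" "m < a" "a \<noteq> m"
    using Cons.prems by force
  then show ?case
    using Cons.prems unfolding insertion_sum_Cons IH
    by cases (rule poly_ext; simp add: poly_monom leD algebra_simps)+
qed auto

text \<open>Double counting of pairs of a word and a marked copy of \<open>m\<close>: deleting the
  marked copy and inserting \<open>m\<close> at that position are mutually inverse. A word arises
  once per copy, which explains the weight.\<close>

lemma sum_count_list_eq_sum_insert:
  fixes f :: "'a list \<Rightarrow> real poly"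
  assumes fin: "finite X" "finite Y" and XY: "\<And>u v. u @ m # v \<in> Y \<longleftrightarrow> u @ v \<in> X"
  shows "(\<Sum>v\<in>Y. smult (real (count_list v m)) (f v)) =
         (\<Sum>w\<in>X. \<Sum>i\<le>length w. f (take i w @ m # drop i w))"
proof -
  have "(\<Sum>v\<in>Y. smult (real (count_list v m)) (f v)) = (\<Sum>v\<in>Y. \<Sum>i\<in>{i. i < length v \<and> v ! i = m}. f v)"
    by (simp add: count_list_eq_length_filter length_filter_conv_card eq_commute of_nat_poly)
  also have "\<dots> = (\<Sum>(v, i)\<in>Sigma Y (\<lambda>v. {i. i < length v \<and> v ! i = m}). f v)"
    using fin by (subst sum.Sigma) auto
  also have "\<dots> = (\<Sum>(w, i)\<in>Sigma X (\<lambda>w. {..length w}). f (take i w @ m # drop i w))"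
  proof (rule sum.reindex_bij_witness[where
        j = "\<lambda>(v, i). (take i v @ drop (Suc i) v, i)" and
        i = "\<lambda>(w, i). (take i w @ m # drop i w, i)"])
    fix vi assume "vi \<in> Sigma Y (\<lambda>v. {i. i < length v \<and> v ! i = m})"
    then obtain v i where vi: "vi = (v, i)" "v \<in> Y" "i < length v" "v ! i = m" by auto
    have eq: "take i v @ m # drop (Suc i) v = v"
      using id_take_nth_drop[OF vi(3)] vi(4) by simp
    show "(case vi of (v, i) \<Rightarrow> (take i v @ drop (Suc i) v, i)) \<in> Sigma X (\<lambda>w. {..length w})"
      using vi XY[of "take i v" "drop (Suc i) v"] eq by auto
    show "(case case vi of (v, i) \<Rightarrow> (take i v @ drop (Suc i) v, i) of
            (w, i) \<Rightarrow> (take i w @ m # drop i w, i)) = vi"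
      using vi eq by simp
    show "(case case vi of (v, i) \<Rightarrow> (take i v @ drop (Suc i) v, i) of
            (w, i) \<Rightarrow> f (take i w @ m # drop i w)) = (case vi of (v, i) \<Rightarrow> f v)"
      using vi eq by simp
  next
    fix wi assume "wi \<in> Sigma X (\<lambda>w. {..length w})"
    then obtain w i where wi: "wi = (w, i)" "w \<in> X" "i \<le> length w" by auto
    show "(case wi of (w, i) \<Rightarrow> (take i w @ m # drop i w, i)) \<in>
            Sigma Y (\<lambda>v. {i. i < length v \<and> v ! i = m})"
      using wi XY[of "take i w" "drop i w"] by (auto simp: nth_append)
    show "(case case wi of (w, i) \<Rightarrow> (take i w @ m # drop i w, i) of
            (v, i) \<Rightarrow> (take i v @ drop (Suc i) v, i)) = wi"
      using wi by simp
  qed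
  also have "\<dots> = (\<Sum>w\<in>X. \<Sum>i\<le>length w. f (take i w @ m # drop i w))"
    using fin by (subst sum.Sigma) auto
  finally show ?thesis .
qed

lemma sum_count_list_eq_insertion_sum:
  assumes "finite X" "finite Y" "\<And>u v. u @ m # v \<in> Y \<longleftrightarrow> u @ v \<in> X"
  shows "(\<Sum>v\<in>Y. monom (real (count_list v m)) (des (a # v))) = (\<Sum>w\<in>X. insertion_sum m a w)"
  using sum_count_list_eq_sum_insert[OF assms, of "\<lambda>v. monom 1 (des (a # v))"]
  by (simp add: smult_monom insertion_sum_def)

section \<open>Recurrences for the descent polynomials\<close>

lemma C_mset_Suc: "C_mset (Suc n) = add_mset (Suc n) (add_mset (Suc n) (C_mset n))"
  by (simp add: C_mset_def)

lemma D_mset_eq: "D_mset n = add_mset (Suc n) (C_mset n)"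
  by (simp add: D_mset_def)

lemma set_C_mset: "set_mset (C_mset n) = {1..n}"
  by (induction n) (auto simp: C_mset_Suc, auto simp: C_mset_def)

lemma size_C_mset: "size (C_mset n) = 2 * n"
  by (induction n) (auto simp: C_mset_Suc, auto simp: C_mset_def)

lemma count_C_mset_Suc: "count (C_mset n) (Suc n) = 0"
  by (simp add: count_eq_zero_iff set_C_mset)

lemma C_perms_iff: "w \<in> C_perms n \<longleftrightarrow> mset w = C_mset n"
  and D_perms_iff: "w \<in> D_perms n \<longleftrightarrow> mset w = D_mset n"
  by (simp_all add: C_perms_def D_perms_def permutations_of_multiset_def)

lemma C_perms_props:
  assumes "w \<in> C_perms n"
  shows "length w = 2 * n" "count_list w (Suc n) = 0" "\<forall>x\<in>set w. x \<le> Suc n"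
proof -
  have w: "mset w = C_mset n" using assms by (simp add: C_perms_iff)
  then show "length w = 2 * n" by (metis size_C_mset size_mset)
  show "count_list w (Suc n) = 0" using w by (simp add: count_C_mset_Suc flip: count_mset)
  show "\<forall>x\<in>set w. x \<le> Suc n" using w set_C_mset[of n] by (metis atLeastAtMost_iff le_SucI set_mset_mset)
qed

lemma D_perms_props:
  assumes "w \<in> D_perms n"
  shows "length w = Suc (2 * n)" "count_list w (Suc n) = 1" "\<forall>x\<in>set w. x \<le> Suc n"
proof -
  have w: "mset w = D_mset n" using assms by (simp add: D_perms_iff)
  then have "size (mset w) = Suc (2 * n)" by (simp add: D_mset_eq size_C_mset)
  then show "length w = Suc (2 * n)" by simp
  show "count_list w (Suc n) = 1" using w by (simp add: D_mset_eq count_C_mset_Suc flip: count_mset)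
  have "set w = insert (Suc n) {1..n}" using w by (metis D_mset_eq set_C_mset set_mset_add_mset_insert set_mset_mset)
  then show "\<forall>x\<in>set w. x \<le> Suc n" by auto
qed

section \<open>Unsigned words\<close>

lemma des_Cons_zero: "des ((0::nat) # w) = des w"
  by (cases w) auto

text \<open>The letter n + 1 is absent before the insertion and occurs once afterwards, so every
  word of \<open>D_perms n\<close> arises exactly once.\<close>

lemma Q_poly_rec: "Q_poly n = eulerian_op 1 (real (2 * n)) 1 (P_poly n)"
proof -
  have "Q_poly n = (\<Sum>v\<in>D_perms n. monom (real (count_list v (Suc n))) (des (0 # v)))"
    unfolding Q_poly_def by (intro sum.cong) (auto simp: D_perms_props des_Cons_zero)
  also have "\<dots> = (\<Sum>w\<in>C_perms n. insertion_sum (Suc n) 0 w)"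
    by (intro sum_count_list_eq_insertion_sum finite_C_perms finite_D_perms)
      (auto simp: C_perms_iff D_perms_iff D_mset_eq)
  also have "\<dots> = (\<Sum>w\<in>C_perms n. monom (1 * real (des w) + 1) (des w) +
      monom (real (2 * n) - 1 * real (des w)) (Suc (des w)))"
    by (intro sum.cong) (auto simp: insertion_sum_max C_perms_props des_Cons_zero)
  also have "\<dots> = eulerian_op 1 (real (2 * n)) 1 (P_poly n)"
    unfolding P_poly_def by (rule eulerian_op_sum_monom)
  finally show ?thesis .
qed

lemma count_list_C_perms_Suc: "w \<in> C_perms (Suc n) \<Longrightarrow> count_list w (Suc n) = 2"
  by (simp add: C_perms_iff C_mset_Suc count_C_mset_Suc flip: count_mset)

text \<open>Each word of \<open>C_perms (Suc n)\<close> arises twice, once for each copy of n + 1.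
  The copy already present contributes one further neutral gap, so a = 2.\<close>

lemma P_poly_rec: "smult 2 (P_poly (Suc n)) = eulerian_op 2 (real (2 * n)) 1 (Q_poly n)"
proof -
  have "smult 2 (P_poly (Suc n)) = (\<Sum>v\<in>C_perms (Suc n). monom (real (count_list v (Suc n))) (des (0 # v)))"
    unfolding P_poly_def smult_sum_right
    by (intro sum.cong) (auto simp: count_list_C_perms_Suc des_Cons_zero smult_monom)
  also have "\<dots> = (\<Sum>w\<in>D_perms n. insertion_sum (Suc n) 0 w)"
    by (intro sum_count_list_eq_insertion_sum finite_C_perms finite_D_perms)
      (auto simp: C_perms_iff D_perms_iff D_mset_eq C_mset_Suc)
  also have "\<dots> = (\<Sum>w\<in>D_perms n. monom (1 * real (des w) + 2) (des w) +
      monom (real (2 * n) - 1 * real (des w)) (Suc (des w)))"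
    by (intro sum.cong) (auto simp: insertion_sum_max D_perms_props des_Cons_zero)
  also have "\<dots> = eulerian_op 2 (real (2 * n)) 1 (Q_poly n)"
    unfolding Q_poly_def by (rule eulerian_op_sum_monom)
  finally show ?thesis .
qed

text \<open>
  Erasing one of the two letters of absolute value \<open>n + 1\<close> may leave a negative one, so the
  recurrence for \<open>S_poly\<close> passes through words in which the sign of \<open>n + 1\<close> is free.
\<close>

definition D_signed_free :: "nat \<Rightarrow> int list set" where
  "D_signed_free n = {w. unsigned_word w \<in> D_perms n}"

definition U_poly :: "nat \<Rightarrow> real poly" where
  "U_poly n = (\<Sum>\<sigma>\<in>D_signed_free n. monom 1 (des_B \<sigma>))"

lemma finite_D_signed_free: "finite (D_signed_free n)"
  unfolding D_signed_free_def by (rule finite_unsigned_word_vimage[OF finite_D_perms])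

section \<open>Signed words\<close>

lemma length_unsigned_word [simp]: "length (unsigned_word w) = length w"
  by (simp add: unsigned_word_def)

lemma count_list_unsigned_word:
  "count_list (unsigned_word w) (Suc n) = count_list w (int (Suc n)) + count_list w (- int (Suc n))"
  by (induction w) (auto simp: unsigned_word_def)

lemma unsigned_word_bounded:
  assumes "\<forall>x\<in>set (unsigned_word w). x \<le> Suc n"
  shows "\<forall>x\<in>set w. x \<le> int (Suc n)" "\<forall>x\<in>set w. - int (Suc n) \<le> x"
  using assms by (fastforce simp: unsigned_word_def)+

text \<open>The positive letter is a maximum and the negative one a minimum. Each sum alone depends
  on the signs of the copies already present; added together, they depend only on the total number
  of copies.\<close>

lemma insertion_sum_signed:
  assumes "\<forall>x\<in>set (unsigned_word w). x \<le> Suc n"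
  defines "k \<equiv> real (count_list (unsigned_word w) (Suc n))"
  shows "insertion_sum (int (Suc n)) 0 w + insertion_sum (- int (Suc n)) 0 w =
    monom (2 * real (des_B w) + (1 + k)) (des_B w) +
    monom (2 * real (length w) + 1 - k - 2 * real (des_B w)) (Suc (des_B w))"
  using insertion_sum_max[of 0 "int (Suc n)" w] insertion_sum_min[of "- int (Suc n)" 0 w]
    unsigned_word_bounded[OF assms(1)]
  by (intro poly_ext) (simp add: des_B_def k_def count_list_unsigned_word poly_monom algebra_simps)

lemma sum_signed_count_list:
  assumes "finite X" "finite Y"
    and "\<And>u m v. nat \<bar>m\<bar> = Suc n \<Longrightarrow> u @ m # v \<in> Y \<longleftrightarrow> u @ v \<in> X"
  shows "(\<Sum>v\<in>Y. monom (real (count_list (unsigned_word v) (Suc n))) (des_B v)) =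
    (\<Sum>w\<in>X. insertion_sum (int (Suc n)) 0 w + insertion_sum (- int (Suc n)) 0 w)"
  using sum_count_list_eq_insertion_sum[OF assms(1,2), of "int (Suc n)" 0]
    sum_count_list_eq_insertion_sum[OF assms(1,2), of "- int (Suc n)" 0] assms(3)
  by (simp add: count_list_unsigned_word sum.distrib des_B_def flip: add_monom)

lemma insert_D_signed_free_iff:
  "nat \<bar>m\<bar> = Suc n \<Longrightarrow> u @ m # v \<in> D_signed_free n \<longleftrightarrow> u @ v \<in> C_signed n"
  by (simp add: D_signed_free_def C_signed_def unsigned_word_def C_perms_iff D_perms_iff D_mset_eq)

lemma insert_C_signed_Suc_iff:
  "nat \<bar>m\<bar> = Suc n \<Longrightarrow> u @ m # v \<in> C_signed (Suc n) \<longleftrightarrow> u @ v \<in> D_signed_free n"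
  by (simp add: D_signed_free_def C_signed_def unsigned_word_def C_perms_iff D_perms_iff D_mset_eq C_mset_Suc)

lemma U_poly_rec: "U_poly n = eulerian_op 1 (real (4 * n + 1)) 2 (S_poly n)"
proof -
  have "U_poly n = (\<Sum>v\<in>D_signed_free n. monom (real (count_list (unsigned_word v) (Suc n))) (des_B v))"
    unfolding U_poly_def by (intro sum.cong) (auto simp: D_signed_free_def D_perms_props)
  also have "\<dots> = (\<Sum>w\<in>C_signed n. insertion_sum (int (Suc n)) 0 w + insertion_sum (- int (Suc n)) 0 w)"
    by (intro sum_signed_count_list finite_C_signed finite_D_signed_free insert_D_signed_free_iff)
  also have "\<dots> = (\<Sum>w\<in>C_signed n. monom (2 * real (des_B w) + 1) (des_B w) +
      monom (real (4 * n + 1) - 2 * real (des_B w)) (Suc (des_B w)))"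
  proof (intro sum.cong refl)
    fix w assume "w \<in> C_signed n"
    then have "unsigned_word w \<in> C_perms n" by (simp add: C_signed_def)
    from C_perms_props[OF this] insertion_sum_signed[of w n]
    show "insertion_sum (int (Suc n)) 0 w + insertion_sum (- int (Suc n)) 0 w =
      monom (2 * real (des_B w) + 1) (des_B w) +
      monom (real (4 * n + 1) - 2 * real (des_B w)) (Suc (des_B w))" by simp
  qed
  also have "\<dots> = eulerian_op 1 (real (4 * n + 1)) 2 (S_poly n)"
    unfolding S_poly_def by (rule eulerian_op_sum_monom)
  finally show ?thesis .
qed

lemma S_poly_rec_U: "S_poly (Suc n) = eulerian_op 1 (real (2 * n + 1)) 1 (U_poly n)"
proof -
  have "smult 2 (S_poly (Suc n)) =
      (\<Sum>v\<in>C_signed (Suc n). monom (real (count_list (unsigned_word v) (Suc n))) (des_B v))"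
    unfolding S_poly_def smult_sum_right
    by (intro sum.cong) (auto simp: C_signed_def count_list_C_perms_Suc smult_monom)
  also have "\<dots> = (\<Sum>w\<in>D_signed_free n. insertion_sum (int (Suc n)) 0 w + insertion_sum (- int (Suc n)) 0 w)"
    by (intro sum_signed_count_list finite_C_signed finite_D_signed_free insert_C_signed_Suc_iff)
  also have "\<dots> = (\<Sum>w\<in>D_signed_free n. monom (2 * real (des_B w) + 2) (des_B w) +
      monom (real (4 * n + 2) - 2 * real (des_B w)) (Suc (des_B w)))"
  proof (intro sum.cong refl)
    fix w assume "w \<in> D_signed_free n"
    then have "unsigned_word w \<in> D_perms n" by (simp add: D_signed_free_def)
    from D_perms_props[OF this] insertion_sum_signed[of w n]
    show "insertion_sum (int (Suc n)) 0 w + insertion_sum (- int (Suc n)) 0 w =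
      monom (2 * real (des_B w) + 2) (des_B w) +
      monom (real (4 * n + 2) - 2 * real (des_B w)) (Suc (des_B w))" by simp
  qed
  also have "\<dots> = eulerian_op 2 (real (4 * n + 2)) 2 (U_poly n)"
    unfolding U_poly_def by (rule eulerian_op_sum_monom)
  also have "\<dots> = smult 2 (eulerian_op 1 (real (2 * n + 1)) 1 (U_poly n))"
    by (simp add: eulerian_op_def smult_add_right)
  finally show ?thesis by (metis smult_cancel zero_neq_numeral)
qed

lemma T_poly_rec: "T_poly n = eulerian_op 1 (real (2 * n)) 1 (S_poly n)"
proof -
  have sub: "D_signed n \<subseteq> D_signed_free n" by (auto simp: D_signed_def D_signed_free_def)
  \<comment> \<open>On \<open>D_signed_free n\<close>, where n + 1 occurs once up to sign, the
    number of positive copies is the indicator of \<open>D_signed n\<close>. This turns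
    \<open>T_poly\<close> into a weighted sum obtained by inserting the positive letter
    alone.\<close>
  have count: "count_list v (int (Suc n)) = (if v \<in> D_signed n then 1 else 0)" if "v \<in> D_signed_free n" for v
  proof (cases "v \<in> D_signed n")
    case True
    then have "count_list v (int (Suc n)) \<noteq> 0" by (auto simp: D_signed_def count_list_0_iff)
    moreover have "count_list (unsigned_word v) (Suc n) = 1"
      using that by (simp add: D_signed_free_def D_perms_props)
    ultimately show ?thesis using True by (simp add: count_list_unsigned_word)
  qed (use that in \<open>auto simp: D_signed_def D_signed_free_def count_list_0_iff\<close>)
  have "T_poly n = (\<Sum>v\<in>D_signed_free n. monom (real (count_list v (int (Suc n)))) (des (0 # v)))"
    unfolding T_poly_def
    using sub count
    by (intro sum.mono_neutral_cong_left finite_D_signed_free) (auto simp del: of_nat_Suc simp: des_B_def subset_iff)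
  also have "\<dots> = (\<Sum>w\<in>C_signed n. insertion_sum (int (Suc n)) 0 w)"
    by (intro sum_count_list_eq_insertion_sum finite_C_signed finite_D_signed_free insert_D_signed_free_iff) simp
  also have "\<dots> = (\<Sum>w\<in>C_signed n. monom (1 * real (des_B w) + 1) (des_B w) +
      monom (real (2 * n) - 1 * real (des_B w)) (Suc (des_B w)))"
  proof (intro sum.cong refl)
    fix w assume "w \<in> C_signed n"
    then have "unsigned_word w \<in> C_perms n" by (simp add: C_signed_def)
    from C_perms_props[OF this] insertion_sum_max[of 0 "int (Suc n)" w] unsigned_word_bounded[of w n]
      count_list_unsigned_word[of w n]
    show "insertion_sum (int (Suc n)) 0 w = monom (1 * real (des_B w) + 1) (des_B w) +
      monom (real (2 * n) - 1 * real (des_B w)) (Suc (des_B w))" by (simp add: des_B_def)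
  qed
  also have "\<dots> = eulerian_op 1 (real (2 * n)) 1 (S_poly n)"
    unfolding S_poly_def by (rule eulerian_op_sum_monom)
  finally show ?thesis .
qed

text \<open>The route from \<open>S_poly n\<close> through \<open>U_poly n\<close> inserts with free
  sign first. Commuting the two operators puts the one that yields \<open>T_poly n\<close> first;
  the required identity holds because both sides equal 4n + 2.\<close>

lemma S_poly_rec: "S_poly (Suc n) = eulerian_op 1 (real (4 * n + 3)) 2 (T_poly n)"
  using eulerian_op_commute[of 1 1 "real (4 * n + 1)" 2 1 "real (2 * n)" "S_poly n"]
  by (simp add: S_poly_rec_U U_poly_rec T_poly_rec algebra_simps)

text \<open>The unsigned chain starts here rather than at index 0, where b = 0 and the operators do
  not raise the degree.\<close>

lemma P_poly_1: "P_poly (Suc 0) = [:1:]"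
proof -
  have "P_poly 0 = [:1:]" by (simp add: P_poly_def C_perms_def C_mset_def monom_0)
  then have "smult 2 (P_poly (Suc 0)) = smult 2 [:1:]"
    using P_poly_rec[of 0] Q_poly_rec[of 0] by (simp add: eulerian_op_def)
  then show ?thesis by (metis smult_cancel zero_neq_numeral)
qed

text \<open>The signed chain starts at \<open>T_poly 0\<close>: the step from
  \<open>S_poly 0\<close> has b = 0 and leaves the constant unchanged.\<close>

lemma T_poly_0: "T_poly 0 = [:1:]"
proof -
  have "C_signed 0 = {[]}" by (auto simp: C_signed_def C_perms_def C_mset_def unsigned_word_def)
  then have "S_poly 0 = [:1:]" by (simp add: S_poly_def des_B_def monom_0)
  then show ?thesis using T_poly_rec[of 0] by (simp add: eulerian_op_def)
qed

section \<open>Interlacing\<close>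

lemma eulerian_op_interlaces:
  assumes "neg_rooted p \<xi>" "a > 0" "c > 0" "b > c * real (degree p)"
  shows "p \<prec>\<^sub>i\<^sub>n\<^sub>t eulerian_op a b c p" "\<exists>\<theta>. neg_rooted (eulerian_op a b c p) \<theta> \<and> length \<theta> = Suc (length \<xi>)"
  using eulerian_op_neg_rooted[OF assms] strictly_interlacesI[OF assms(1)] by metis+

lemma P_poly_step:
  assumes P: "neg_rooted (P_poly (Suc n)) \<xi>" "length \<xi> = 2 * n"
  shows "P_poly (Suc n) \<prec>\<^sub>i\<^sub>n\<^sub>t Q_poly (Suc n)" "Q_poly (Suc n) \<prec>\<^sub>i\<^sub>n\<^sub>t P_poly (Suc (Suc n))"
    "\<exists>\<theta>. neg_rooted (P_poly (Suc (Suc n))) \<theta> \<and> length \<theta> = 2 * Suc n"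
proof -
  have "1 * real (degree (P_poly (Suc n))) < real (2 * Suc n)"
    using P by (simp add: neg_rooted_degree)
  note step = eulerian_op_interlaces[OF P(1) zero_less_one zero_less_one this, folded Q_poly_rec]
  show "P_poly (Suc n) \<prec>\<^sub>i\<^sub>n\<^sub>t Q_poly (Suc n)" by (rule step)
  obtain \<theta> where \<theta>: "neg_rooted (Q_poly (Suc n)) \<theta>" "length \<theta> = Suc (2 * n)"
    using step(2) P by auto
  have "1/2 * real (degree (Q_poly (Suc n))) < real (Suc n)"
    using \<theta> by (simp add: neg_rooted_degree)
  \<comment> \<open>Halving all three parameters absorbs the factor 2 of the recurrence, so that
    interlacing is obtained for the polynomial itself and not for its double.\<close>
  moreover have "P_poly (Suc (Suc n)) = eulerian_op 1 (real (Suc n)) (1/2) (Q_poly (Suc n))"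
  proof -
    have "P_poly (Suc (Suc n)) = smult (1/2) (smult 2 (P_poly (Suc (Suc n))))" by simp
    also have "\<dots> = eulerian_op 1 (real (Suc n)) (1/2) (Q_poly (Suc n))"
      unfolding P_poly_rec by (intro poly_ext) (simp add: poly_eulerian_op field_simps)
    finally show ?thesis .
  qed
  ultimately show "Q_poly (Suc n) \<prec>\<^sub>i\<^sub>n\<^sub>t P_poly (Suc (Suc n))"
    "\<exists>\<theta>. neg_rooted (P_poly (Suc (Suc n))) \<theta> \<and> length \<theta> = 2 * Suc n"
    using eulerian_op_interlaces[OF \<theta>(1), of 1 "1/2" "real (Suc n)"] \<theta>(2) by simp_all
qed

lemma P_poly_neg_rooted: "\<exists>\<xi>. neg_rooted (P_poly (Suc n)) \<xi> \<and> length \<xi> = 2 * n"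
proof (induction n)
  case 0
  then show ?case using neg_rooted_const[of 1] by (auto simp: P_poly_1)
next
  case (Suc n)
  then show ?case using P_poly_step(3) by blast
qed

text \<open>The degree condition b > c deg p reads 4n + 3 > 2 (2n).\<close>

lemma T_poly_interlaces_S_poly:
  assumes T: "neg_rooted (T_poly n) \<theta>" "length \<theta> = 2 * n"
  shows "T_poly n \<prec>\<^sub>i\<^sub>n\<^sub>t S_poly (Suc n)"
    "\<exists>\<xi>. neg_rooted (S_poly (Suc n)) \<xi> \<and> length \<xi> = Suc (2 * n)"
  using eulerian_op_interlaces[OF T(1), of 1 2 "real (4 * n + 3)"] T
  by (simp_all add: S_poly_rec neg_rooted_degree)

text \<open>The degree condition b > c deg p reads 2n + 2 > 2n + 1.\<close>

lemma S_poly_interlaces_T_poly: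
  assumes S: "neg_rooted (S_poly (Suc n)) \<xi>" "length \<xi> = Suc (2 * n)"
  shows "S_poly (Suc n) \<prec>\<^sub>i\<^sub>n\<^sub>t T_poly (Suc n)"
    "\<exists>\<theta>. neg_rooted (T_poly (Suc n)) \<theta> \<and> length \<theta> = 2 * Suc n"
  using eulerian_op_interlaces[OF S(1), of 1 1 "real (2 * Suc n)"] S
  by (simp_all add: T_poly_rec neg_rooted_degree)

lemma T_poly_neg_rooted: "\<exists>\<theta>. neg_rooted (T_poly n) \<theta> \<and> length \<theta> = 2 * n"
proof (induction n)
  case 0
  then show ?case using neg_rooted_const[of 1] by (auto simp: T_poly_0)
next
  case (Suc n)
  then show ?case using T_poly_interlaces_S_poly(2) S_poly_interlaces_T_poly(2) by blast
qed

theorem corollary5: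
  fixes n :: nat
  assumes "n \<ge> 1"
  shows "only_real_zeros (P_poly n) \<and> only_real_zeros (Q_poly n) \<and>
         only_real_zeros (T_poly n) \<and> only_real_zeros (S_poly n) \<and>
         P_poly n \<prec>\<^sub>i\<^sub>n\<^sub>t Q_poly n \<and> Q_poly n \<prec>\<^sub>i\<^sub>n\<^sub>t P_poly (n + 1) \<and>
         S_poly n \<prec>\<^sub>i\<^sub>n\<^sub>t T_poly n \<and> T_poly n \<prec>\<^sub>i\<^sub>n\<^sub>t S_poly (n + 1)"
proof -
  obtain k where n: "n = Suc k" using assms by (cases n) auto
  have "P_poly n \<prec>\<^sub>i\<^sub>n\<^sub>t Q_poly n" "Q_poly n \<prec>\<^sub>i\<^sub>n\<^sub>t P_poly (n + 1)"
    using P_poly_neg_rooted[of k] P_poly_step n by auto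
  moreover have "T_poly n \<prec>\<^sub>i\<^sub>n\<^sub>t S_poly (n + 1)"
    using T_poly_neg_rooted[of n] T_poly_interlaces_S_poly(1) by auto
  moreover have "S_poly n \<prec>\<^sub>i\<^sub>n\<^sub>t T_poly n"
    using T_poly_neg_rooted[of k] T_poly_interlaces_S_poly(2) S_poly_interlaces_T_poly(1) n by blast
  ultimately show ?thesis
    by (simp add: strictly_interlaces_def)
qed

end
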